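(* Let $A$ be an ISP-domain and let $P$ be a prime ideal of $A$. Then $A/P$ is an ISP-domain.
   Context: All rings are commutative and unitary; "ideal" of a domain means integral ideal. A domain $A$ is an ISP-domain (invertible semiprime domain) if every proper nonzero ideal $I$ of $A$ can be written as $I=JQ_1\cdots Q_n$ where $n\geq 1$, $J$ is an invertible ideal of $A$ and each $Q_i$ is a proper radical ideal of $A$. *)

theory Defs
  imports "HOL-Algebra.Ideal_Product" "HOL-Algebra.QuotRing"
begin

definition fracs :: "('a, 'b) ring_scheme \<Rightarrow> ('a \<times> 'a) set" where
  "fracs A = carrier A \<times> (carrier A - {\<zero>\<^bsub>A\<^esub>})"

definition frac_rel :: "('a, 'b) ring_scheme \<Rightarrow> (('a \<times> 'a) \<times> ('a \<times> 'a)) set" where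
  "frac_rel A = {((a, b), (c, d)). (a, b) \<in> fracs A \<and> (c, d) \<in> fracs A \<and>
     a \<otimes>\<^bsub>A\<^esub> d = c \<otimes>\<^bsub>A\<^esub> b}"

definition frac :: "('a, 'b) ring_scheme \<Rightarrow> 'a \<Rightarrow> 'a \<Rightarrow> ('a \<times> 'a) set" where
  "frac A a b = frac_rel A `` {(a, b)}"

text \<open>
  The unions over all representatives collapse to a single equivalence class,
  see \<open>frac_mult\<close> and \<open>frac_add\<close> below.
\<close>

definition frac_field :: "('a, 'b) ring_scheme \<Rightarrow> ('a \<times> 'a) set ring" where
  "frac_field A =
     \<lparr>carrier = fracs A // frac_rel A,
      mult = (\<lambda>X Y. \<Union>(a, b)\<in>X. \<Union>(c, d)\<in>Y. frac A (a \<otimes>\<^bsub>A\<^esub> c) (b \<otimes>\<^bsub>A\<^esub> d)),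
      one = frac A \<one>\<^bsub>A\<^esub> \<one>\<^bsub>A\<^esub>,
      zero = frac A \<zero>\<^bsub>A\<^esub> \<one>\<^bsub>A\<^esub>,
      add = (\<lambda>X Y. \<Union>(a, b)\<in>X. \<Union>(c, d)\<in>Y.
        frac A (a \<otimes>\<^bsub>A\<^esub> d \<oplus>\<^bsub>A\<^esub> c \<otimes>\<^bsub>A\<^esub> b) (b \<otimes>\<^bsub>A\<^esub> d))\<rparr>"

definition frac_embed :: "('a, 'b) ring_scheme \<Rightarrow> 'a \<Rightarrow> ('a \<times> 'a) set" where
  "frac_embed A a = frac A a \<one>\<^bsub>A\<^esub>"

lemma UN_pair_const:
  assumes "p \<in> S" "q \<in> T"
    and "\<And>a b c d. (a, b) \<in> S \<Longrightarrow> (c, d) \<in> T \<Longrightarrow> f a b c d = C"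
  shows "(\<Union>(a, b)\<in>S. \<Union>(c, d)\<in>T. f a b c d) = C"
proof -
  have "(\<Union>(a, b)\<in>S. \<Union>(c, d)\<in>T. f a b c d) = (\<Union>x\<in>S. \<Union>y\<in>T. C)"
    by (intro SUP_cong refl) (auto simp: assms(3))
  then show ?thesis using assms(1,2) by auto
qed

context "domain"
begin

lemma equiv_frac_rel: "equiv (fracs R) (frac_rel R)"
proof (rule equivI)
  show "frac_rel R \<subseteq> fracs R \<times> fracs R"
    by (auto simp: frac_rel_def)
  show "refl_on (fracs R) (frac_rel R)"
    by (auto simp: refl_on_def frac_rel_def fracs_def)
  show "sym (frac_rel R)"
    by (auto simp: sym_def frac_rel_def)
  show "trans (frac_rel R)"
  proof (rule transI, clarify)
    fix a b c d e f
    assume h1: "((a, b), (c, d)) \<in> frac_rel R" and h2: "((c, d), (e, f)) \<in> frac_rel R"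
    have cl: "a \<in> carrier R" "b \<in> carrier R" "c \<in> carrier R" "d \<in> carrier R" "d \<noteq> \<zero>"
      "e \<in> carrier R" "f \<in> carrier R"
      and e1: "a \<otimes> d = c \<otimes> b" and e2: "c \<otimes> f = e \<otimes> d"
      using h1 h2 by (auto simp: frac_rel_def fracs_def)
    have "d \<otimes> (a \<otimes> f) = (a \<otimes> d) \<otimes> f" using cl by (simp add: m_ac)
    also have "\<dots> = (c \<otimes> f) \<otimes> b" using cl by (simp add: e1 m_ac)
    also have "\<dots> = d \<otimes> (e \<otimes> b)" using cl by (simp add: e2 m_ac)
    finally have "a \<otimes> f = e \<otimes> b" using cl m_lcancel by simp
    then show "((a, b), (e, f)) \<in> frac_rel R"
      using h1 h2 by (auto simp: frac_rel_def)
  qed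
qed

lemma frac_eq_iff:
  assumes "(a, b) \<in> fracs R" "(c, d) \<in> fracs R"
  shows "frac R a b = frac R c d \<longleftrightarrow> a \<otimes> d = c \<otimes> b"
  using eq_equiv_class_iff[OF equiv_frac_rel assms] assms
  by (simp add: frac_def frac_rel_def)

lemma fracs_mult:
  assumes "(a, b) \<in> fracs R" "(c, d) \<in> fracs R"
  shows "(a \<otimes> c, b \<otimes> d) \<in> fracs R"
  using assms by (auto simp: fracs_def dest: integral)

lemma fracs_add:
  assumes "(a, b) \<in> fracs R" "(c, d) \<in> fracs R"
  shows "(a \<otimes> d \<oplus> c \<otimes> b, b \<otimes> d) \<in> fracs R"
  using assms by (auto simp: fracs_def dest: integral)

lemma frac_mult:
  assumes "(a, b) \<in> fracs R" "(c, d) \<in> fracs R"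
  shows "frac R a b \<otimes>\<^bsub>frac_field R\<^esub> frac R c d = frac R (a \<otimes> c) (b \<otimes> d)"
proof -
  have "frac R (a' \<otimes> c') (b' \<otimes> d') = frac R (a \<otimes> c) (b \<otimes> d)"
    if "(a', b') \<in> frac R a b" "(c', d') \<in> frac R c d" for a' b' c' d'
  proof -
    have m: "(a', b') \<in> fracs R" "(c', d') \<in> fracs R" and e: "a \<otimes> b' = a' \<otimes> b" "c \<otimes> d' = c' \<otimes> d"
      using that by (auto simp: frac_def frac_rel_def)
    have cl: "a \<in> carrier R" "b \<in> carrier R" "c \<in> carrier R" "d \<in> carrier R"
      "a' \<in> carrier R" "b' \<in> carrier R" "c' \<in> carrier R" "d' \<in> carrier R"
      using assms m by (auto simp: fracs_def)
    have "(a' \<otimes> c') \<otimes> (b \<otimes> d) = (a' \<otimes> b) \<otimes> (c' \<otimes> d)" using cl by (simp add: m_ac)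
    also have "\<dots> = (a \<otimes> b') \<otimes> (c \<otimes> d')" by (simp only: e)
    also have "\<dots> = (a \<otimes> c) \<otimes> (b' \<otimes> d')" using cl by (simp add: m_ac)
    finally show ?thesis
      using frac_eq_iff[OF fracs_mult[OF m] fracs_mult[OF assms]] by simp
  qed
  moreover have "(a, b) \<in> frac R a b" "(c, d) \<in> frac R c d"
    using equiv_class_self[OF equiv_frac_rel] assms by (simp_all add: frac_def)
  ultimately show ?thesis
    unfolding frac_field_def ring.simps monoid.simps by (rule UN_pair_const[rotated 2])
qed

lemma frac_add:
  assumes "(a, b) \<in> fracs R" "(c, d) \<in> fracs R"
  shows "frac R a b \<oplus>\<^bsub>frac_field R\<^esub> frac R c d = frac R (a \<otimes> d \<oplus> c \<otimes> b) (b \<otimes> d)"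
proof -
  have "frac R (a' \<otimes> d' \<oplus> c' \<otimes> b') (b' \<otimes> d') = frac R (a \<otimes> d \<oplus> c \<otimes> b) (b \<otimes> d)"
    if "(a', b') \<in> frac R a b" "(c', d') \<in> frac R c d" for a' b' c' d'
  proof -
    have m: "(a', b') \<in> fracs R" "(c', d') \<in> fracs R" and e: "a \<otimes> b' = a' \<otimes> b" "c \<otimes> d' = c' \<otimes> d"
      using that by (auto simp: frac_def frac_rel_def)
    have cl: "a \<in> carrier R" "b \<in> carrier R" "c \<in> carrier R" "d \<in> carrier R"
      "a' \<in> carrier R" "b' \<in> carrier R" "c' \<in> carrier R" "d' \<in> carrier R"
      using assms m by (auto simp: fracs_def)
    have "(a' \<otimes> d' \<oplus> c' \<otimes> b') \<otimes> (b \<otimes> d) =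
        (a' \<otimes> b) \<otimes> (d' \<otimes> d) \<oplus> (c' \<otimes> d) \<otimes> (b' \<otimes> b)"
      using cl by (simp add: l_distr r_distr m_ac)
    also have "\<dots> = (a \<otimes> b') \<otimes> (d' \<otimes> d) \<oplus> (c \<otimes> d') \<otimes> (b' \<otimes> b)" by (simp only: e)
    also have "\<dots> = (a \<otimes> d \<oplus> c \<otimes> b) \<otimes> (b' \<otimes> d')"
      using cl by (simp add: l_distr r_distr m_ac)
    finally show ?thesis
      using frac_eq_iff[OF fracs_add[OF m] fracs_add[OF assms]] by simp
  qed
  moreover have "(a, b) \<in> frac R a b" "(c, d) \<in> frac R c d"
    using equiv_class_self[OF equiv_frac_rel] assms by (simp_all add: frac_def)
  ultimately show ?thesis
    unfolding frac_field_def ring.simps monoid.simps by (rule UN_pair_const[rotated 2])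
qed

lemma frac_carrier: "x \<in> carrier (frac_field R) \<longleftrightarrow> (\<exists>a b. (a, b) \<in> fracs R \<and> x = frac R a b)"
  by (auto simp: frac_field_def quotient_def frac_def)

lemma frac_zero: "\<zero>\<^bsub>frac_field R\<^esub> = frac R \<zero> \<one>"
  and frac_one: "\<one>\<^bsub>frac_field R\<^esub> = frac R \<one> \<one>"
  by (simp_all add: frac_field_def)

lemma field_frac_field: "field (frac_field R)"
proof (rule cring.cring_fieldI2)
  have m01: "(\<zero>, \<one>) \<in> fracs R" "(\<one>, \<one>) \<in> fracs R" by (auto simp: fracs_def)
  show "\<zero>\<^bsub>frac_field R\<^esub> \<noteq> \<one>\<^bsub>frac_field R\<^esub>"
    using frac_eq_iff[OF m01] by (simp add: frac_zero frac_one)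
  show "\<exists>y\<in>carrier (frac_field R). x \<otimes>\<^bsub>frac_field R\<^esub> y = \<one>\<^bsub>frac_field R\<^esub>"
    if x: "x \<in> carrier (frac_field R)" "x \<noteq> \<zero>\<^bsub>frac_field R\<^esub>" for x
  proof -
    obtain a b where ab: "(a, b) \<in> fracs R" "x = frac R a b" using x frac_carrier by blast
    have "a \<noteq> \<zero>" using x ab frac_eq_iff[OF ab(1) m01(1)] by (auto simp: frac_zero fracs_def)
    then have ba: "(b, a) \<in> fracs R" using ab by (auto simp: fracs_def)
    have "x \<otimes>\<^bsub>frac_field R\<^esub> frac R b a = frac R (a \<otimes> b) (b \<otimes> a)"
      using frac_mult[OF ab(1) ba] ab by simp
    also have "\<dots> = frac R \<one> \<one>"
      using frac_eq_iff[OF fracs_mult[OF ab(1) ba] m01(2)] ab by (auto simp: fracs_def m_comm)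
    finally show ?thesis using ba frac_carrier frac_one by metis
  qed
  show "cring (frac_field R)"
  proof (rule cringI)
    show "abelian_group (frac_field R)"
    proof (rule abelian_groupI)
      fix x y z
      assume "x \<in> carrier (frac_field R)" "y \<in> carrier (frac_field R)" "z \<in> carrier (frac_field R)"
      then obtain a b c d e f where
        m: "(a, b) \<in> fracs R" "(c, d) \<in> fracs R" "(e, f) \<in> fracs R"
        and xyz: "x = frac R a b" "y = frac R c d" "z = frac R e f"
        using frac_carrier by metis
      have cl: "a \<in> carrier R" "b \<in> carrier R" "c \<in> carrier R" "d \<in> carrier R"
        "e \<in> carrier R" "f \<in> carrier R"
        using m by (auto simp: fracs_def)
      show "x \<oplus>\<^bsub>frac_field R\<^esub> y \<oplus>\<^bsub>frac_field R\<^esub> z = x \<oplus>\<^bsub>frac_field R\<^esub> (y \<oplus>\<^bsub>frac_field R\<^esub> z)"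
        using m by (simp add: xyz frac_add fracs_add) (use cl in \<open>simp add: l_distr r_distr m_ac a_ac\<close>)
    next
      fix x y
      assume "x \<in> carrier (frac_field R)" "y \<in> carrier (frac_field R)"
      then obtain a b c d where
        m: "(a, b) \<in> fracs R" "(c, d) \<in> fracs R" and xy: "x = frac R a b" "y = frac R c d"
        using frac_carrier by metis
      have cl: "a \<in> carrier R" "b \<in> carrier R" "c \<in> carrier R" "d \<in> carrier R"
        using m by (auto simp: fracs_def)
      show "x \<oplus>\<^bsub>frac_field R\<^esub> y = y \<oplus>\<^bsub>frac_field R\<^esub> x"
        using m cl by (simp add: xy frac_add m_ac a_ac)
      show "x \<oplus>\<^bsub>frac_field R\<^esub> y \<in> carrier (frac_field R)"
        using frac_carrier fracs_add m frac_add xy by metis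
    next
      show "\<zero>\<^bsub>frac_field R\<^esub> \<in> carrier (frac_field R)"
        using frac_carrier frac_zero m01 by metis
    next
      fix x assume "x \<in> carrier (frac_field R)"
      then obtain a b where m: "(a, b) \<in> fracs R" and x: "x = frac R a b"
        using frac_carrier by metis
      have cl: "a \<in> carrier R" "b \<in> carrier R" using m by (auto simp: fracs_def)
      show "\<zero>\<^bsub>frac_field R\<^esub> \<oplus>\<^bsub>frac_field R\<^esub> x = x"
        using m cl m01 by (simp add: x frac_zero frac_add)
      have n: "(\<ominus> a, b) \<in> fracs R" using m by (auto simp: fracs_def)
      have "frac R (\<ominus> a) b \<oplus>\<^bsub>frac_field R\<^esub> x = \<zero>\<^bsub>frac_field R\<^esub>"
        using frac_eq_iff[OF fracs_add[OF n m] m01(1)] cl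
        by (simp add: x frac_zero frac_add[OF n m] l_minus l_neg)
      then show "\<exists>y\<in>carrier (frac_field R). y \<oplus>\<^bsub>frac_field R\<^esub> x = \<zero>\<^bsub>frac_field R\<^esub>"
        using n frac_carrier by blast
    qed
    show "comm_monoid (frac_field R)"
    proof (rule comm_monoidI)
      fix x y z
      assume "x \<in> carrier (frac_field R)" "y \<in> carrier (frac_field R)" "z \<in> carrier (frac_field R)"
      then obtain a b c d e f where
        m: "(a, b) \<in> fracs R" "(c, d) \<in> fracs R" "(e, f) \<in> fracs R"
        and xyz: "x = frac R a b" "y = frac R c d" "z = frac R e f"
        using frac_carrier by metis
      have cl: "a \<in> carrier R" "b \<in> carrier R" "c \<in> carrier R" "d \<in> carrier R"
        "e \<in> carrier R" "f \<in> carrier R"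
        using m by (auto simp: fracs_def)
      show "x \<otimes>\<^bsub>frac_field R\<^esub> y \<otimes>\<^bsub>frac_field R\<^esub> z = x \<otimes>\<^bsub>frac_field R\<^esub> (y \<otimes>\<^bsub>frac_field R\<^esub> z)"
        using m by (simp add: xyz frac_mult fracs_mult) (use cl in \<open>simp add: m_ac\<close>)
    next
      fix x y
      assume "x \<in> carrier (frac_field R)" "y \<in> carrier (frac_field R)"
      then obtain a b c d where
        m: "(a, b) \<in> fracs R" "(c, d) \<in> fracs R" and xy: "x = frac R a b" "y = frac R c d"
        using frac_carrier by metis
      have cl: "a \<in> carrier R" "b \<in> carrier R" "c \<in> carrier R" "d \<in> carrier R"
        using m by (auto simp: fracs_def)
      show "x \<otimes>\<^bsub>frac_field R\<^esub> y = y \<otimes>\<^bsub>frac_field R\<^esub> x"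
        using m cl by (simp add: xy frac_mult m_ac)
      show "x \<otimes>\<^bsub>frac_field R\<^esub> y \<in> carrier (frac_field R)"
        using frac_carrier fracs_mult m frac_mult xy by metis
    next
      show "\<one>\<^bsub>frac_field R\<^esub> \<in> carrier (frac_field R)"
        using frac_carrier frac_one m01 by metis
    next
      fix x assume "x \<in> carrier (frac_field R)"
      then obtain a b where m: "(a, b) \<in> fracs R" and x: "x = frac R a b"
        using frac_carrier by metis
      show "\<one>\<^bsub>frac_field R\<^esub> \<otimes>\<^bsub>frac_field R\<^esub> x = x"
        using m m01 by (simp add: x frac_one frac_mult) (auto simp: fracs_def)
    qed
    fix x y z
    assume "x \<in> carrier (frac_field R)" "y \<in> carrier (frac_field R)" "z \<in> carrier (frac_field R)"
    then obtain a b c d e f where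
      m: "(a, b) \<in> fracs R" "(c, d) \<in> fracs R" "(e, f) \<in> fracs R"
      and xyz: "x = frac R a b" "y = frac R c d" "z = frac R e f"
      using frac_carrier by metis
    have cl: "a \<in> carrier R" "b \<in> carrier R" "c \<in> carrier R" "d \<in> carrier R"
      "e \<in> carrier R" "f \<in> carrier R"
      using m by (auto simp: fracs_def)
    let ?l1 = "(a \<otimes> d \<oplus> c \<otimes> b) \<otimes> e" and ?l2 = "(b \<otimes> d) \<otimes> f"
    let ?r1 = "(a \<otimes> e) \<otimes> (d \<otimes> f) \<oplus> (c \<otimes> e) \<otimes> (b \<otimes> f)" and ?r2 = "(b \<otimes> f) \<otimes> (d \<otimes> f)"
    have "?l1 \<otimes> ?r2 = ?r1 \<otimes> ?l2"
      using cl by (simp add: l_distr r_distr m_ac)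
    then have "frac R ?l1 ?l2 = frac R ?r1 ?r2"
      using frac_eq_iff[OF fracs_mult[OF fracs_add[OF m(1,2)] m(3)]
          fracs_add[OF fracs_mult[OF m(1,3)] fracs_mult[OF m(2,3)]]] by simp
    then show "(x \<oplus>\<^bsub>frac_field R\<^esub> y) \<otimes>\<^bsub>frac_field R\<^esub> z =
        x \<otimes>\<^bsub>frac_field R\<^esub> z \<oplus>\<^bsub>frac_field R\<^esub> y \<otimes>\<^bsub>frac_field R\<^esub> z"
      using m by (simp add: xyz frac_add frac_mult fracs_add fracs_mult)
  qed
qed

lemma frac_embed_hom: "frac_embed R \<in> ring_hom R (frac_field R)"
proof (rule ring_hom_memI)
  have e: "(a, \<one>) \<in> fracs R" if "a \<in> carrier R" for a
    using that by (simp add: fracs_def)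
  fix x y assume xy: "x \<in> carrier R" "y \<in> carrier R"
  show "frac_embed R x \<in> carrier (frac_field R)"
    using xy e frac_carrier by (auto simp: frac_embed_def)
  show "frac_embed R (x \<otimes> y) = frac_embed R x \<otimes>\<^bsub>frac_field R\<^esub> frac_embed R y"
    using xy by (simp add: frac_embed_def frac_mult e)
  show "frac_embed R (x \<oplus> y) = frac_embed R x \<oplus>\<^bsub>frac_field R\<^esub> frac_embed R y"
    using xy by (simp add: frac_embed_def frac_add e)
qed (simp add: frac_embed_def frac_one)

lemma inj_on_frac_embed: "inj_on (frac_embed R) (carrier R)"
  by (rule inj_onI) (simp add: frac_embed_def frac_eq_iff fracs_def)

end

definition ideal_inverse :: "('a, 'b) ring_scheme \<Rightarrow> 'a set \<Rightarrow> ('a \<times> 'a) set set" where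
  "ideal_inverse A J = {x \<in> carrier (frac_field A).
     \<forall>j\<in>J. x \<otimes>\<^bsub>frac_field A\<^esub> frac_embed A j \<in> frac_embed A ` carrier A}"

text \<open>
  The product in the fraction field is again \<open>ideal_prod\<close>, which forms all finite sums of
  products of elements of two arbitrary subsets.
\<close>

definition invertible_ideal :: "('a, 'b) ring_scheme \<Rightarrow> 'a set \<Rightarrow> bool" where
  "invertible_ideal A J \<longleftrightarrow> ideal J A \<and>
     ideal_prod (frac_field A) (frac_embed A ` J) (ideal_inverse A J) = frac_embed A ` carrier A"

definition radical :: "('a, 'b) ring_scheme \<Rightarrow> 'a set \<Rightarrow> 'a set" where
  "radical A I = {x \<in> carrier A. \<exists>n::nat. n \<ge> 1 \<and> x [^]\<^bsub>A\<^esub> n \<in> I}"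

definition radical_ideal :: "('a, 'b) ring_scheme \<Rightarrow> 'a set \<Rightarrow> bool" where
  "radical_ideal A I \<longleftrightarrow> ideal I A \<and> radical A I = I"

text \<open>The left fold below is the product \<open>J \<cdot> Q\<^sub>1 \<cdot> \<dots> \<cdot> Q\<^sub>n\<close> for \<open>Qs = [Q\<^sub>1, \<dots>, Q\<^sub>n]\<close>.\<close>

definition isp_domain :: "('a, 'b) ring_scheme \<Rightarrow> bool" where
  "isp_domain A \<longleftrightarrow> domain A \<and>
     (\<forall>I. ideal I A \<and> I \<noteq> carrier A \<and> I \<noteq> {\<zero>\<^bsub>A\<^esub>} \<longrightarrow>
       (\<exists>J Qs. invertible_ideal A J \<and> Qs \<noteq> [] \<and>
          (\<forall>Q\<in>set Qs. radical_ideal A Q \<and> Q \<noteq> carrier A) \<and>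
          I = foldl (ideal_prod A) J Qs))"

end

theory Submission
  imports Defs
begin

text \<open>
  Let \<open>h\<close> be the projection onto \<open>A / P\<close>. A proper nonzero ideal of \<open>A / P\<close> is \<open>h ` I\<close> with
  \<open>P \<subset> I \<subset> A\<close>. In a factorisation \<open>I = J Q\<^sub>1 \<cdots> Q\<^sub>n\<close> all factors contain \<open>I\<close>, hence \<open>P\<close>, so the
  \<open>h ` Q\<^sub>i\<close> are again proper and radical. To push down invertibility of \<open>J\<close>, pick \<open>d \<in> J - P\<close>;
  clearing denominators by \<open>d\<close>, invertibility is a relation \<open>d = \<Sum> j\<^sub>i b\<^sub>i\<close> with \<open>j\<^sub>i \<in> J\<close> and
  \<open>b\<^sub>i J \<subseteq> d A\<close>, which involves no fractions and survives reduction modulo \<open>P\<close>.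
\<close>

section \<open>Iterated products of ideals\<close>

lemma foldl_ideal_prod_ideal:
  assumes "ring R" "ideal J R" "\<forall>Q\<in>set Qs. ideal Q R"
  shows "ideal (foldl (ideal_prod R) J Qs) R"
  using assms(2,3) by (induction Qs arbitrary: J) (auto intro: ring.ideal_prod_is_ideal[OF assms(1)])

text \<open>This is what puts the kernel inside every factor of a factorisation. The induction is
  from the right because \<open>foldl\<close> has the last factor outermost, and a product of two
  ideals lies in their intersection.\<close>

lemma foldl_ideal_prod_subset:
  assumes "ring R" "ideal J R" "\<forall>Q\<in>set Qs. ideal Q R" "X = J \<or> X \<in> set Qs"
  shows "foldl (ideal_prod R) J Qs \<subseteq> X"
  using assms(2-4)
proof (induction Qs rule: rev_induct)
  case (snoc Q Qs)
  have "ideal_prod R (foldl (ideal_prod R) J Qs) Q \<subseteq> foldl (ideal_prod R) J Qs \<inter> Q"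
    using snoc.prems by (intro ring.ideal_prod_inter foldl_ideal_prod_ideal assms(1)) auto
  then show ?case using snoc by auto
qed auto

section \<open>Images of ideals under ring homomorphisms\<close>

context ring_hom_ring
begin

text \<open>Stated for subsets instead of ideals because it is later applied to a set of numerators
  that is never shown to be an ideal.\<close>

lemma image_ideal_prod:
  assumes "I \<subseteq> carrier R" "J \<subseteq> carrier R"
  shows "h ` ideal_prod R I J = ideal_prod S (h ` I) (h ` J)"
proof -
  have cl: "x \<in> carrier R" if "x \<in> ideal_prod R I J" for x
    using that by induction (use assms in auto)
  show ?thesis
  proof (intro equalityI subsetI)
    fix y assume "y \<in> h ` ideal_prod R I J"
    then obtain x where "x \<in> ideal_prod R I J" "y = h x" by blast
    then show "y \<in> ideal_prod S (h ` I) (h ` J)"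
    proof (induction arbitrary: y)
      case (prod i j)
      then have "y = h i \<otimes>\<^bsub>S\<^esub> h j" using assms by (simp add: subset_iff)
      then show ?case using prod by (auto intro: ideal_prod.prod)
    next
      case (sum x x')
      then have "y = h x \<oplus>\<^bsub>S\<^esub> h x'" using cl by auto
      then show ?case using sum by (auto intro: ideal_prod.sum)
    qed
  next
    fix y assume "y \<in> ideal_prod S (h ` I) (h ` J)"
    then show "y \<in> h ` ideal_prod R I J"
    proof induction
      case (prod i j)
      then obtain a b where ab: "a \<in> I" "b \<in> J" "i = h a" "j = h b" by blast
      then have "i \<otimes>\<^bsub>S\<^esub> j = h (a \<otimes> b)" using assms by (simp add: subset_iff)
      then show ?case using ideal_prod.prod[OF ab(1,2)] by (metis imageI)
    next
      case (sum y y')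
      then obtain x x' where x: "x \<in> ideal_prod R I J" "x' \<in> ideal_prod R I J" "y = h x" "y' = h x'"
        by blast
      then have "y \<oplus>\<^bsub>S\<^esub> y' = h (x \<oplus> x')" using cl by auto
      then show ?case using ideal_prod.sum[OF x(1,2)] by (metis imageI)
    qed
  qed
qed

lemma image_foldl_ideal_prod:
  assumes "ideal J R" "\<forall>Q\<in>set Qs. ideal Q R"
  shows "h ` foldl (ideal_prod R) J Qs = foldl (ideal_prod S) (h ` J) (map ((`) h) Qs)"
  using assms
proof (induction Qs arbitrary: J)
  case (Cons Q Qs)
  then have "h ` ideal_prod R J Q = ideal_prod S (h ` J) (h ` Q)"
    by (auto intro!: image_ideal_prod dest: ideal.Icarr)
  moreover have "ideal (ideal_prod R J Q) R"
    using Cons.prems by (auto intro: R.ideal_prod_is_ideal)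
  ultimately show ?case using Cons by auto
qed auto

lemma image_ideal:
  assumes "h ` carrier R = carrier S" "ideal I R"
  shows "ideal (h ` I) S"
proof (rule idealI[OF S.ring_axioms])
  interpret I: ideal I R by fact
  show "subgroup (h ` I) (add_monoid S)"
    by (rule img_is_add_subgroup[OF I.a_subgroup])
next
  interpret I: ideal I R by fact
  fix a x assume "a \<in> h ` I" "x \<in> carrier S"
  then obtain i r where "a = h i" "i \<in> I" "x = h r" "r \<in> carrier R" using assms(1) by blast
  then show "x \<otimes>\<^bsub>S\<^esub> a \<in> h ` I" "a \<otimes>\<^bsub>S\<^esub> x \<in> h ` I"
    using I.I_l_closed I.I_r_closed I.Icarr
    by (simp_all flip: hom_mult)
qed

text \<open>If \<open>x\<close> and some \<open>i\<close> in \<open>I\<close> have the same image,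
  they differ by a kernel element, which already lies in \<open>I\<close>. Membership can thus be
  tested after applying \<open>h\<close>.\<close>

lemma mem_image_iff_of_kernel_subset:
  assumes "ideal I R" "a_kernel R S h \<subseteq> I" "x \<in> carrier R"
  shows "h x \<in> h ` I \<longleftrightarrow> x \<in> I"
proof
  interpret I: ideal I R by fact
  assume "h x \<in> h ` I"
  then obtain i where i: "i \<in> I" "h x = h i" by blast
  have iR: "i \<in> carrier R" using i(1) by (rule I.Icarr)
  have "h (x \<ominus> i) = h x \<oplus>\<^bsub>S\<^esub> \<ominus>\<^bsub>S\<^esub> h i" using assms(3) iR by (simp add: a_minus_def)
  also have "\<dots> = \<zero>\<^bsub>S\<^esub>" unfolding i(2) using iR by (intro S.r_neg) simp
  finally have "x \<ominus> i \<in> a_kernel R S h" unfolding a_kernel_def'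
    using R.minus_closed[OF assms(3) iR] by blast
  then have "x \<ominus> i \<in> I" using assms(2) by blast
  then have "(x \<ominus> i) \<oplus> i \<in> I" using i(1) by (rule I.a_closed)
  moreover have "(x \<ominus> i) \<oplus> i = x"
    using assms(3) iR by (simp add: a_minus_def R.a_assoc R.l_neg)
  ultimately show "x \<in> I" by simp
qed auto

lemma image_radical_ideal:
  assumes "h ` carrier R = carrier S" "radical_ideal R Q" "a_kernel R S h \<subseteq> Q"
  shows "radical_ideal S (h ` Q)"
proof -
  have Q: "ideal Q R" "radical R Q = Q" using assms(2) by (auto simp: radical_ideal_def)
  have "radical S (h ` Q) = h ` radical R Q"
  proof (intro equalityI subsetI)
    fix y assume "y \<in> radical S (h ` Q)"
    then obtain n :: nat where n: "y \<in> carrier S" "n \<ge> 1" "y [^]\<^bsub>S\<^esub> n \<in> h ` Q"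
      by (auto simp: radical_def)
    then obtain x where x: "x \<in> carrier R" "y = h x" using assms(1) by blast
    then have "h (x [^] n) \<in> h ` Q" using n by (simp add: hom_nat_pow)
    then have "x [^] n \<in> Q" using mem_image_iff_of_kernel_subset[OF Q(1) assms(3)] x by simp
    then show "y \<in> h ` radical R Q" using x n(2) by (auto simp: radical_def)
  next
    fix y assume "y \<in> h ` radical R Q"
    then obtain x and n :: nat where "x \<in> carrier R" "y = h x" "n \<ge> 1" "x [^] n \<in> Q"
      by (auto simp: radical_def)
    then show "y \<in> radical S (h ` Q)"
      by (auto simp: radical_def simp flip: hom_nat_pow intro!: exI[of _ n])
  qed
  then show ?thesis using Q image_ideal[OF assms(1)] by (simp add: radical_ideal_def)
qed

end

section \<open>Invertibility expressed without fractions\<close>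

context "domain"
begin

text \<open>Write 1 as a sum of products \<open>j x\<close> with \<open>j\<close> in
  \<open>J\<close> and \<open>x\<close> in the inverse of \<open>J\<close>, and multiply by
  \<open>d\<close>. Each \<open>b = d x\<close> lies in the ring since \<open>d\<close> is in
  \<open>J\<close>, and \<open>b k = d (x k)\<close> is a multiple of \<open>d\<close> for every
  \<open>k\<close> in \<open>J\<close>.\<close>

lemma invertible_ideal_clear_denominator:
  assumes inv: "invertible_ideal R J" and d: "d \<in> J"
  shows "d \<in> ideal_prod R J {b \<in> carrier R. \<forall>j\<in>J. \<exists>a\<in>carrier R. b \<otimes> j = d \<otimes> a}"
    (is "d \<in> ideal_prod R J ?B")
proof -
  interpret J: ideal J R using inv by (simp add: invertible_ideal_def)
  interpret K: field "frac_field R" by (rule field_frac_field)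
  interpret e: ring_hom_ring R "frac_field R" "frac_embed R"
    by (rule ring_hom_ringI2[OF ring_axioms K.ring_axioms frac_embed_hom])
  have BJ: "y \<in> carrier R" if "y \<in> ideal_prod R J ?B" for y
    using that by induction (use J.Icarr in auto)
  have dR: "d \<in> carrier R" using d J.Icarr by blast
  have xK: "x \<in> carrier (frac_field R)"
    if "x \<in> ideal_prod (frac_field R) (frac_embed R ` J) (ideal_inverse R J)" for x
    using that by induction (use J.Icarr in \<open>auto simp: ideal_inverse_def\<close>)
  \<comment> \<open>Only \<open>x = 1\<close> is wanted, but the induction over finite sums needs
    the claim for the whole product of \<open>J\<close> with its inverse.\<close>
  have *: "\<exists>y\<in>ideal_prod R J ?B. frac_embed R y = frac_embed R d \<otimes>\<^bsub>frac_field R\<^esub> x"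
    if "x \<in> ideal_prod (frac_field R) (frac_embed R ` J) (ideal_inverse R J)" for x
    using that
  proof induction
    case (prod u x)
    then obtain j where j: "j \<in> J" "u = frac_embed R j" by blast
    have x: "x \<in> carrier (frac_field R)"
      and xj: "\<And>j. j \<in> J \<Longrightarrow> x \<otimes>\<^bsub>frac_field R\<^esub> frac_embed R j \<in> frac_embed R ` carrier R"
      using prod by (auto simp: ideal_inverse_def)
    \<comment> \<open>\<open>b\<close> is the numerator of \<open>x\<close> over the denominator
      \<open>d\<close>.\<close>
    obtain b where b: "b \<in> carrier R" "x \<otimes>\<^bsub>frac_field R\<^esub> frac_embed R d = frac_embed R b"
      using xj[OF d] by auto
    have "\<exists>a\<in>carrier R. b \<otimes> k = d \<otimes> a" if k: "k \<in> J" for k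
    proof -
      obtain a where a: "a \<in> carrier R" "x \<otimes>\<^bsub>frac_field R\<^esub> frac_embed R k = frac_embed R a"
        using xj[OF k] by auto
      have kR: "k \<in> carrier R" using k J.Icarr by blast
      have "frac_embed R (b \<otimes> k) =
          x \<otimes>\<^bsub>frac_field R\<^esub> frac_embed R d \<otimes>\<^bsub>frac_field R\<^esub> frac_embed R k"
        using b kR by simp
      also have "\<dots> = frac_embed R d \<otimes>\<^bsub>frac_field R\<^esub> (x \<otimes>\<^bsub>frac_field R\<^esub> frac_embed R k)"
        using x dR kR by (simp add: K.m_ac)
      also have "\<dots> = frac_embed R (d \<otimes> a)" using a dR by simp
      finally have "b \<otimes> k = d \<otimes> a"
        using inj_onD[OF inj_on_frac_embed] a b dR kR by simp
      then show ?thesis using a by blast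
    qed
    then have "j \<otimes> b \<in> ideal_prod R J ?B" using j b by (intro ideal_prod.prod) auto
    moreover have "frac_embed R (j \<otimes> b) = frac_embed R d \<otimes>\<^bsub>frac_field R\<^esub> (u \<otimes>\<^bsub>frac_field R\<^esub> x)"
      using x dR j J.Icarr[OF j(1)] b(1) by (simp add: b(2)[symmetric] K.m_ac)
    ultimately show ?case by blast
  next
    case (sum x x')
    then obtain y y' where y: "y \<in> ideal_prod R J ?B" "y' \<in> ideal_prod R J ?B"
      "frac_embed R y = frac_embed R d \<otimes>\<^bsub>frac_field R\<^esub> x"
      "frac_embed R y' = frac_embed R d \<otimes>\<^bsub>frac_field R\<^esub> x'" by blast
    then have "frac_embed R (y \<oplus> y') = frac_embed R d \<otimes>\<^bsub>frac_field R\<^esub> (x \<oplus>\<^bsub>frac_field R\<^esub> x')"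
      unfolding K.r_distr[OF xK[OF sum.hyps(1)] xK[OF sum.hyps(2)] e.hom_closed[OF dR]]
      using e.hom_add[OF BJ[OF y(1)] BJ[OF y(2)]] by (simp only:)
    then show ?case by (rule bexI) (rule ideal_prod.sum[OF y(1,2)])
  qed
  have "\<one>\<^bsub>frac_field R\<^esub> \<in> ideal_prod (frac_field R) (frac_embed R ` J) (ideal_inverse R J)"
    using inv e.hom_one by (auto simp: invertible_ideal_def simp flip: e.hom_one)
  from *[OF this] obtain y where y: "y \<in> ideal_prod R J ?B"
    "frac_embed R y = frac_embed R d \<otimes>\<^bsub>frac_field R\<^esub> \<one>\<^bsub>frac_field R\<^esub>" by blast
  then have "y = d" using inj_onD[OF inj_on_frac_embed _ BJ[OF y(1)] dR] dR by simp
  then show ?thesis using y(1) by simp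
qed

text \<open>The converse direction: each \<open>b / d\<close> with \<open>b\<close> in
  \<open>B\<close> lies in the inverse of \<open>J\<close>, and dividing the given expression of
  \<open>d\<close> by \<open>d\<close> writes 1 as a sum of products from \<open>J\<close> and its
  inverse.\<close>

lemma invertible_idealI:
  assumes J: "ideal J R" and d: "d \<in> carrier R" "d \<noteq> \<zero>"
    and B: "B \<subseteq> carrier R" "\<And>b j. b \<in> B \<Longrightarrow> j \<in> J \<Longrightarrow> \<exists>a\<in>carrier R. b \<otimes> j = d \<otimes> a"
    and dJB: "d \<in> ideal_prod R J B"
  shows "invertible_ideal R J"
proof -
  interpret J: ideal J R by fact
  interpret K: field "frac_field R" by (rule field_frac_field)
  interpret e: ring_hom_ring R "frac_field R" "frac_embed R"
    by (rule ring_hom_ringI2[OF ring_axioms K.ring_axioms frac_embed_hom])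
  let ?P = "ideal_prod (frac_field R) (frac_embed R ` J) (ideal_inverse R J)"
  define v where "v = inv\<^bsub>frac_field R\<^esub> frac_embed R d"
  have "frac_embed R d \<noteq> \<zero>\<^bsub>frac_field R\<^esub>"
    using inj_onD[OF inj_on_frac_embed, of d \<zero>] d by auto
  then have "frac_embed R d \<in> Units (frac_field R)"
    using d by (simp add: K.field_Units)
  then have v: "v \<in> carrier (frac_field R)"
    "frac_embed R d \<otimes>\<^bsub>frac_field R\<^esub> v = \<one>\<^bsub>frac_field R\<^esub>"
    by (auto simp: v_def)
  have JB: "y \<in> carrier R" if "y \<in> ideal_prod R J B" for y
    using that by induction (use J.Icarr B in auto)
  have "x \<in> frac_embed R ` carrier R" if "x \<in> ?P" for x
    using that
  proof induction
    case (prod u x)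
    then show ?case using J.Icarr by (auto simp: ideal_inverse_def K.m_comm)
  next
    case (sum x x')
    then show ?case by (auto simp flip: e.hom_add)
  qed
  moreover have "frac_embed R a \<in> ?P" if a: "a \<in> carrier R" for a
  proof -
    \<comment> \<open>Generalises from \<open>d\<close> to every \<open>y\<close> in
      \<open>J B\<close>, so that induction applies: \<open>a y / d\<close> lies in
      \<open>?P\<close>. At \<open>y = d\<close> this is \<open>a\<close> itself.\<close>
    have "frac_embed R a \<otimes>\<^bsub>frac_field R\<^esub> v \<otimes>\<^bsub>frac_field R\<^esub> frac_embed R y \<in> ?P"
      if "y \<in> ideal_prod R J B" for y
      using that
    proof induction
      case (prod j b)
      then have jb: "j \<in> carrier R" "b \<in> carrier R" using J.Icarr B by auto
      let ?x = "frac_embed R a \<otimes>\<^bsub>frac_field R\<^esub> v \<otimes>\<^bsub>frac_field R\<^esub> frac_embed R b"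
      \<comment> \<open>Here \<open>?x\<close> is \<open>a b / d\<close>. From
        \<open>b k = d c\<close> one gets \<open>?x k = a c\<close>, so \<open>?x\<close> is in the
        inverse of \<open>J\<close>.\<close>
      have "?x \<otimes>\<^bsub>frac_field R\<^esub> frac_embed R k \<in> frac_embed R ` carrier R" if k: "k \<in> J" for k
      proof -
        obtain c where c: "c \<in> carrier R" "b \<otimes> k = d \<otimes> c" using B(2) prod k by blast
        have kR: "k \<in> carrier R" using k J.Icarr by blast
        have "?x \<otimes>\<^bsub>frac_field R\<^esub> frac_embed R k =
            frac_embed R a \<otimes>\<^bsub>frac_field R\<^esub> v \<otimes>\<^bsub>frac_field R\<^esub> frac_embed R (b \<otimes> k)"
          using a v jb kR by (simp add: K.m_assoc)
        also have "\<dots> = frac_embed R a \<otimes>\<^bsub>frac_field R\<^esub> frac_embed R c \<otimes>\<^bsub>frac_field R\<^esub>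
            (frac_embed R d \<otimes>\<^bsub>frac_field R\<^esub> v)"
          using a v(1) c d by (simp add: K.m_ac)
        also have "\<dots> = frac_embed R (a \<otimes> c)" using v a c by simp
        finally show ?thesis by (simp only:) (intro imageI m_closed a c(1))
      qed
      then have "?x \<in> ideal_inverse R J" using a v jb by (simp add: ideal_inverse_def)
      then have "frac_embed R j \<otimes>\<^bsub>frac_field R\<^esub> ?x \<in> ?P"
        using prod by (auto intro: ideal_prod.prod)
      moreover have "frac_embed R j \<otimes>\<^bsub>frac_field R\<^esub> ?x =
          frac_embed R a \<otimes>\<^bsub>frac_field R\<^esub> v \<otimes>\<^bsub>frac_field R\<^esub> frac_embed R (j \<otimes> b)"
        using a v jb by (simp add: K.m_ac)
      ultimately show ?case by simp
    next
      case (sum y y')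
      then show ?case using a v JB by (simp add: K.r_distr ideal_prod.sum)
    qed
    from this[OF dJB] show ?thesis using a v d by (simp add: K.m_assoc K.m_comm[of v])
  qed
  ultimately have "?P = frac_embed R ` carrier R" by blast
  then show ?thesis using J by (simp add: invertible_ideal_def)
qed

end

section \<open>Descent to a homomorphic image\<close>

context ring_hom_ring
begin

text \<open>The relation that places \<open>d\<close> in \<open>J B\<close> uses ring operations
  only, so \<open>h\<close> carries it over to \<open>S\<close>. There \<open>h d\<close> serves as
  the new denominator, which is why it must be nonzero.\<close>

lemma image_invertible_ideal:
  assumes dom: "domain R" "domain S" and surj: "h ` carrier R = carrier S"
    and J: "invertible_ideal R J" and d: "d \<in> J" "h d \<noteq> \<zero>\<^bsub>S\<^esub>"
  shows "invertible_ideal S (h ` J)"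
proof -
  interpret J: ideal J R using J by (simp add: invertible_ideal_def)
  \<comment> \<open>As \<open>d\<close> is a nonzero element of \<open>J\<close>, this is
    \<open>d\<close> times the inverse of \<open>J\<close>, viewed inside \<open>R\<close>.\<close>
  define B where "B = {b \<in> carrier R. \<forall>j\<in>J. \<exists>a\<in>carrier R. b \<otimes> j = d \<otimes> a}"
  have JB: "J \<subseteq> carrier R" "B \<subseteq> carrier R" using J.Icarr by (auto simp: B_def)
  have dR: "d \<in> carrier R" using d JB by blast
  have "d \<in> ideal_prod R J B"
    unfolding B_def by (rule domain.invertible_ideal_clear_denominator[OF dom(1) J d(1)])
  then have "h d \<in> ideal_prod S (h ` J) (h ` B)" using image_ideal_prod[OF JB] by blast
  moreover have "\<exists>a\<in>carrier S. b \<otimes>\<^bsub>S\<^esub> j = h d \<otimes>\<^bsub>S\<^esub> a" if "b \<in> h ` B" "j \<in> h ` J" for b j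
  proof -
    obtain b' j' where b: "b' \<in> B" "b = h b'" and j: "j' \<in> J" "j = h j'"
      using \<open>b \<in> h ` B\<close> \<open>j \<in> h ` J\<close> by blast
    then obtain a where a: "a \<in> carrier R" "b' \<otimes> j' = d \<otimes> a" by (auto simp: B_def)
    have "b \<otimes>\<^bsub>S\<^esub> j = h (b' \<otimes> j')" using b j JB by auto
    also have "\<dots> = h d \<otimes>\<^bsub>S\<^esub> h a" using a dR by simp
    finally show ?thesis by (rule bexI) (use a in simp)
  qed
  moreover have "h d \<in> carrier S" "h ` B \<subseteq> carrier S" using dR JB(2) by auto
  ultimately show ?thesis
    using domain.invertible_idealI[OF dom(2) image_ideal[OF surj J.ideal_axioms] _ d(2)] by blast
qed

text \<open>Factor the full preimage of the given ideal in \<open>R\<close> and map each factor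
  forward. The preimage contains the kernel, and so do all its factors.\<close>

lemma isp_domain_image:
  assumes isp: "isp_domain R" and S: "domain S" and surj: "h ` carrier R = carrier S"
  shows "isp_domain S"
  unfolding isp_domain_def
proof (intro conjI allI impI S)
  fix I' assume I': "ideal I' S \<and> I' \<noteq> carrier S \<and> I' \<noteq> {\<zero>\<^bsub>S\<^esub>}"
  interpret I': ideal I' S using I' by simp
  define I where "I = {r \<in> carrier R. h r \<in> I'}"
  have hI: "h ` I = I'"
  proof (intro equalityI subsetI)
    fix y assume y: "y \<in> I'"
    then obtain x where "x \<in> carrier R" "y = h x" using surj I'.Icarr by (metis imageE)
    then show "y \<in> h ` I" using y by (simp add: I_def)
  qed (auto simp: I_def)
  have I: "ideal I R" unfolding I_def using ideal_vimage I' by blast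
  \<comment> \<open>A nonzero element of \<open>I'\<close> is lifted to \<open>d\<close>. It shows
    that \<open>I\<close> is nonzero and, since \<open>I\<close> lies in \<open>J\<close>, later
    acts as the denominator for \<open>J\<close>.\<close>
  obtain d where d: "d \<in> I" "h d \<noteq> \<zero>\<^bsub>S\<^esub>" using hI I' I'.zero_closed by blast
  have "I \<noteq> {\<zero>}" using d by auto
  moreover have "I \<noteq> carrier R" using hI surj I' by auto
  ultimately obtain J Qs where J: "invertible_ideal R J" and Qs: "Qs \<noteq> []"
    "\<forall>Q\<in>set Qs. radical_ideal R Q \<and> Q \<noteq> carrier R" and IJ: "I = foldl (ideal_prod R) J Qs"
    using isp I unfolding isp_domain_def by blast
  have iJ: "ideal J R" and iQ: "\<forall>Q\<in>set Qs. ideal Q R"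
    using J Qs by (auto simp: invertible_ideal_def radical_ideal_def)
  have sub: "I \<subseteq> J" "\<And>Q. Q \<in> set Qs \<Longrightarrow> I \<subseteq> Q"
    using foldl_ideal_prod_subset[OF R.ring_axioms iJ iQ] IJ by auto
  have ker: "a_kernel R S h \<subseteq> I" unfolding a_kernel_def' I_def using I'.zero_closed by auto
  have "radical_ideal S (h ` Q) \<and> h ` Q \<noteq> carrier S" if Q: "Q \<in> set Qs" for Q
  proof
    have kQ: "a_kernel R S h \<subseteq> Q" using ker sub(2)[OF Q] by blast
    then show "radical_ideal S (h ` Q)" using image_radical_ideal[OF surj] Qs Q by blast
    interpret Q: ideal Q R using iQ Q by blast
    \<comment> \<open>Properness survives because an element outside \<open>Q\<close> stays outside
      after applying \<open>h\<close>, the kernel being contained in \<open>Q\<close>.\<close>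
    obtain x where x: "x \<in> carrier R" "x \<notin> Q" using Qs(2) Q Q.a_subset by blast
    then have "h x \<notin> h ` Q" using mem_image_iff_of_kernel_subset[OF Q.ideal_axioms kQ] by simp
    then show "h ` Q \<noteq> carrier S" using hom_closed[OF x(1)] by metis
  qed
  moreover have "invertible_ideal S (h ` J)"
    using image_invertible_ideal[OF _ S surj J] isp d sub(1) by (auto simp: isp_domain_def)
  moreover have "I' = foldl (ideal_prod S) (h ` J) (map ((`) h) Qs)"
    using image_foldl_ideal_prod[OF iJ iQ] hI IJ by simp
  ultimately show "\<exists>J Qs. invertible_ideal S J \<and> Qs \<noteq> [] \<and>
      (\<forall>Q\<in>set Qs. radical_ideal S Q \<and> Q \<noteq> carrier S) \<and> I' = foldl (ideal_prod S) J Qs"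
    using Qs(1) by (intro exI[of _ "h ` J"] exI[of _ "map ((`) h) Qs"]) auto
qed

end

theorem proposition2:
  fixes A :: "('a, 'b) ring_scheme" and P :: "'a set"
  assumes "isp_domain A" and "primeideal P A"
  shows "isp_domain (A Quot P)"
proof -
  interpret P: primeideal P A by fact
  show ?thesis
  \<comment> \<open>Primeness of \<open>P\<close> makes the quotient a domain; surjectivity of the
    projection is the one remaining goal.\<close>
  proof (rule ring_hom_ring.isp_domain_image[OF P.rcos_ring_hom_ring assms(1) P.quotient_is_domain])
    show "(+>\<^bsub>A\<^esub>) P ` carrier A = carrier (A Quot P)"
      by (auto simp: FactRing_def A_RCOSETS_def')
  qed
qed

end
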